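(* Let $\Pi$ be a (locally trace class) operator of orthogonal projection onto a closed subspace $L\subset L_2(\mathbb R,\mu)$ whose kernel is integrable and satisfies the following: there is a set $U\subset\mathbb R$ with $\mu(\mathbb R\setminus U)=0$ such that: (i) for any $q\in U$ the function $v_q(x)=\Pi(x,q)$ lies in $L_2(\mathbb R,\mu)$ and $\Pi f(q)=\langle f,v_q\rangle$ for all $f\in L_2(\mathbb R,\mu)$; thus every $\varphi\in L$ is defined everywhere on $U$ by $\varphi(q)=\langle\varphi,v_q\rangle$, and identities between functions in $L$ are understood on $U$; (ii) $\langle v_q,v_q\rangle=\Pi(q,q)$ for all $q\in U$ and $\mathrm{tr}(\chi_B\Pi\chi_B)=\int_B\Pi(q,q)\,d\mu(q)$ for all bounded Borel $B$; (iii) (needed only in the continuous case) if $q\in U$, $\varphi\in L$, $\varphi(q)=0$, then $\varphi(x)/(x-q)\in L_2(\mathbb R,\mu)$. Then: if $p\in U$ and $\varphi\in L$ are such that $\varphi(p)=0$, there exists $\psi\in L$ such that $\varphi(x)=(x-p)\psi(x)$.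
   Context: $\mu$ is a $\sigma$-finite Borel measure on $\mathbb R$, and one of two cases holds: the continuous case, $\mu(\{p\})=0$ for all $p\in\mathbb R$; or the discrete case, $\mu$ is the counting measure on a countable subset $E\subset\mathbb R$ without accumulation points. $\langle f,h\rangle=\int f\bar h\,d\mu$. Locally trace class: $\chi_B\Pi\chi_B$ is trace class for every bounded Borel $B$. Integrable kernel, continuous case: the full-measure set $U\subset\mathbb R$ (that is, $\mu(\mathbb R\setminus U)=0$) on which the kernel and the functions in $L$ are defined pointwise can be taken open and there are linearly independent smooth functions $A,B$ on $U$, never simultaneously equal to $0$, with $$\Pi(x,y)=\frac{A(x)B(y)-A(y)B(x)}{x-y}\quad(x\ne y),\qquad \Pi(x,x)=A'(x)B(x)-A(x)B'(x).$$ Integrable kernel, discrete case: $U=E$ and there are linearly independent functions $A,B$ on $E$, never simultaneously $0$, such that $\Pi(x,y)=\frac{A(x)B(y)-A(y)B(x)}{x-y}$ for all $x\ne y$ in $E$ (no requirement on the diagonal, no smoothness). *)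

theory Defs
  imports "HOL-Analysis.Analysis"
begin

text \<open>
  Elements of \<open>L\<^sub>2(M)\<close> are represented by square-integrable functions, with equality almost
  everywhere in place of equality of classes.  Operators act on representatives, and all conditions
  on them are insensitive to the choice of representative.
\<close>

definition L2_space :: "'a measure \<Rightarrow> ('a \<Rightarrow> complex) set" where
  "L2_space M = {f \<in> borel_measurable M. integrable M (\<lambda>x. (cmod (f x))\<^sup>2)}"

definition L2_inner :: "'a measure \<Rightarrow> ('a \<Rightarrow> complex) \<Rightarrow> ('a \<Rightarrow> complex) \<Rightarrow> complex" where
  "L2_inner M f h = (LINT x|M. f x * cnj (h x))"

definition L2_nrm :: "'a measure \<Rightarrow> ('a \<Rightarrow> complex) \<Rightarrow> real" where
  "L2_nrm M f = sqrt (LINT x|M. (cmod (f x))\<^sup>2)"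

text \<open>
  Closedness makes \<open>L\<close> a union of classes: if \<open>g = f\<close> a.e. and \<open>f \<in> L\<close>, then the constant sequence
  \<open>f\<close> converges to \<open>g\<close>.
\<close>

definition closed_L2_subspace :: "'a measure \<Rightarrow> ('a \<Rightarrow> complex) set \<Rightarrow> bool" where
  "closed_L2_subspace M L \<longleftrightarrow>
     L \<subseteq> L2_space M \<and>
     (\<lambda>x. 0) \<in> L \<and>
     (\<forall>f\<in>L. \<forall>g\<in>L. (\<lambda>x. f x + g x) \<in> L) \<and>
     (\<forall>c. \<forall>f\<in>L. (\<lambda>x. c * f x) \<in> L) \<and>
     (\<forall>s g. (\<forall>n::nat. s n \<in> L) \<longrightarrow> g \<in> L2_space M \<longrightarrow>
        (\<lambda>n. L2_nrm M (\<lambda>x. s n x - g x)) \<longlonglongrightarrow> 0 \<longrightarrow> g \<in> L)"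

definition L2_orth_projection ::
  "'a measure \<Rightarrow> ('a \<Rightarrow> complex) set \<Rightarrow> (('a \<Rightarrow> complex) \<Rightarrow> 'a \<Rightarrow> complex) \<Rightarrow> bool" where
  "L2_orth_projection M L P \<longleftrightarrow>
     (\<forall>f\<in>L2_space M. P f \<in> L \<and> (\<forall>g\<in>L. L2_inner M (\<lambda>x. f x - P f x) g = 0))"

definition bounded_L2_operator ::
  "'a measure \<Rightarrow> (('a \<Rightarrow> complex) \<Rightarrow> 'a \<Rightarrow> complex) \<Rightarrow> bool" where
  "bounded_L2_operator M T \<longleftrightarrow>
     (\<forall>f\<in>L2_space M. T f \<in> L2_space M) \<and>
     (\<forall>f\<in>L2_space M. \<forall>g\<in>L2_space M. AE x in M. T (\<lambda>y. f y + g y) x = T f x + T g x) \<and>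
     (\<forall>c. \<forall>f\<in>L2_space M. AE x in M. T (\<lambda>y. c * f y) x = c * T f x) \<and>
     (\<exists>C. \<forall>f\<in>L2_space M. L2_nrm M (T f) \<le> C * L2_nrm M f)"

text \<open>
  \<open>S\<close> is the absolute value of \<open>T\<close>: the positive operator with \<open>S\<^sup>* S = T\<^sup>* T\<close>
  (a positive operator on a complex Hilbert space is self-adjoint).
\<close>

definition L2_operator_abs ::
  "'a measure \<Rightarrow> (('a \<Rightarrow> complex) \<Rightarrow> 'a \<Rightarrow> complex) \<Rightarrow> (('a \<Rightarrow> complex) \<Rightarrow> 'a \<Rightarrow> complex) \<Rightarrow> bool" where
  "L2_operator_abs M T S \<longleftrightarrow>
     bounded_L2_operator M S \<and>
     (\<forall>f\<in>L2_space M. Im (L2_inner M (S f) f) = 0 \<and> 0 \<le> Re (L2_inner M (S f) f)) \<and>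
     (\<forall>f\<in>L2_space M. \<forall>g\<in>L2_space M. L2_inner M (S f) (S g) = L2_inner M (T f) (T g))"

definition L2_orthonormal_basis :: "'a measure \<Rightarrow> ('a \<Rightarrow> complex) set \<Rightarrow> bool" where
  "L2_orthonormal_basis M b \<longleftrightarrow>
     b \<subseteq> L2_space M \<and>
     (\<forall>e\<in>b. \<forall>e'\<in>b. L2_inner M e e' = (if e = e' then 1 else 0)) \<and>
     (\<forall>f\<in>L2_space M. (\<forall>e\<in>b. L2_inner M f e = 0) \<longrightarrow> (AE x in M. f x = 0))"

definition trace_class ::
  "'a measure \<Rightarrow> (('a \<Rightarrow> complex) \<Rightarrow> 'a \<Rightarrow> complex) \<Rightarrow> bool" where
  "trace_class M T \<longleftrightarrow>
     bounded_L2_operator M T \<and>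
     (\<exists>S b. L2_operator_abs M T S \<and> L2_orthonormal_basis M b \<and>
        (\<lambda>e. Re (L2_inner M (S e) e)) summable_on b)"

text \<open>For trace-class \<open>T\<close> the sum below does not depend on the orthonormal basis.\<close>

definition has_L2_trace ::
  "'a measure \<Rightarrow> (('a \<Rightarrow> complex) \<Rightarrow> 'a \<Rightarrow> complex) \<Rightarrow> complex \<Rightarrow> bool" where
  "has_L2_trace M T t \<longleftrightarrow>
     (\<forall>b. L2_orthonormal_basis M b \<longrightarrow> ((\<lambda>e. L2_inner M (T e) e) has_sum t) b)"

definition compression ::
  "'a set \<Rightarrow> (('a \<Rightarrow> complex) \<Rightarrow> 'a \<Rightarrow> complex) \<Rightarrow> ('a \<Rightarrow> complex) \<Rightarrow> 'a \<Rightarrow> complex" where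
  "compression B T f = (\<lambda>x. indicator B x * T (\<lambda>y. indicator B y * f y) x)"

definition locally_trace_class ::
  "real measure \<Rightarrow> ((real \<Rightarrow> complex) \<Rightarrow> real \<Rightarrow> complex) \<Rightarrow> bool" where
  "locally_trace_class M T \<longleftrightarrow>
     (\<forall>B\<in>sets borel. bounded B \<longrightarrow> trace_class M (compression B T))"

text \<open>
  \<open>C\<^sup>\<infinity>\<close> on an open subset of the line.  On an open set the iterated derivatives at a point of \<open>U\<close>
  depend only on the values of \<open>F\<close> in \<open>U\<close>.
\<close>

definition smooth_on_open :: "real set \<Rightarrow> (real \<Rightarrow> complex) \<Rightarrow> bool" where
  "smooth_on_open U F \<longleftrightarrow>
     (\<forall>n. \<forall>x\<in>U. ((\<lambda>G t. vector_derivative G (at t)) ^^ n) F differentiable (at x))"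

definition lin_indep_on :: "real set \<Rightarrow> (real \<Rightarrow> complex) \<Rightarrow> (real \<Rightarrow> complex) \<Rightarrow> bool" where
  "lin_indep_on U A B \<longleftrightarrow> (\<forall>a b. (\<forall>x\<in>U. a * A x + b * B x = 0) \<longrightarrow> a = 0 \<and> b = 0)"

text \<open>
  A kernel on \<open>U \<times> U\<close> is a total function \<open>K\<close>; its values outside \<open>U \<times> U\<close> are never used.
\<close>

definition integrable_kernel_off_diag ::
  "real set \<Rightarrow> (real \<Rightarrow> complex) \<Rightarrow> (real \<Rightarrow> complex) \<Rightarrow> (real \<Rightarrow> real \<Rightarrow> complex) \<Rightarrow> bool" where
  "integrable_kernel_off_diag U A B K \<longleftrightarrow>
     (\<forall>x\<in>U. \<forall>y\<in>U. x \<noteq> y \<longrightarrow> K x y = (A x * B y - A y * B x) / complex_of_real (x - y))"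

definition integrable_kernel_continuous ::
  "real set \<Rightarrow> (real \<Rightarrow> real \<Rightarrow> complex) \<Rightarrow> bool" where
  "integrable_kernel_continuous U K \<longleftrightarrow>
     open U \<and>
     (\<exists>A B. smooth_on_open U A \<and> smooth_on_open U B \<and> lin_indep_on U A B \<and>
        (\<forall>x\<in>U. \<not> (A x = 0 \<and> B x = 0)) \<and>
        integrable_kernel_off_diag U A B K \<and>
        (\<forall>x\<in>U. K x x = vector_derivative A (at x) * B x - A x * vector_derivative B (at x)))"

definition integrable_kernel_discrete ::
  "real set \<Rightarrow> (real \<Rightarrow> real \<Rightarrow> complex) \<Rightarrow> bool" where
  "integrable_kernel_discrete E K \<longleftrightarrow>
     (\<exists>A B. lin_indep_on E A B \<and> (\<forall>x\<in>E. \<not> (A x = 0 \<and> B x = 0)) \<and>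
        integrable_kernel_off_diag E A B K)"

text \<open>The function \<open>v\<^sub>q(x) = K(x, q)\<close>, extended by zero off the full-measure set \<open>U\<close>.\<close>

definition kernel_section ::
  "real set \<Rightarrow> (real \<Rightarrow> real \<Rightarrow> complex) \<Rightarrow> real \<Rightarrow> real \<Rightarrow> complex" where
  "kernel_section U K q = (\<lambda>x. if x \<in> U then K x q else 0)"

text \<open>
  The value at \<open>q \<in> U\<close> of an element \<open>\<phi>\<close> of \<open>L\<close>, namely \<open>\<langle>\<phi>, v\<^sub>q\<rangle>\<close>.  It depends only on the class of
  \<open>\<phi>\<close>, unlike the value \<open>\<phi> q\<close> of the representative.
\<close>

definition value_at ::
  "real measure \<Rightarrow> real set \<Rightarrow> (real \<Rightarrow> real \<Rightarrow> complex) \<Rightarrow> (real \<Rightarrow> complex) \<Rightarrow> real \<Rightarrow> complex" where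
  "value_at M U K \<phi> q = L2_inner M \<phi> (kernel_section U K q)"

text \<open>
  \<open>P f (q) = \<langle>f, v\<^sub>q\<rangle>\<close> is required of the class of \<open>P f\<close> for almost every \<open>q\<close>, and of the pointwise
  value of \<open>P f\<close> as an element of \<open>L\<close> for every \<open>q \<in> U\<close>.  The latter says that \<open>v\<^sub>q \<in> L\<close>, which the
  a.e. identity alone does not give at points \<open>q \<in> U\<close> outside the support of \<open>M\<close>.
\<close>

definition pointwise_kernel ::
  "real measure \<Rightarrow> real set \<Rightarrow> (real \<Rightarrow> real \<Rightarrow> complex) \<Rightarrow>
   ((real \<Rightarrow> complex) \<Rightarrow> real \<Rightarrow> complex) \<Rightarrow> bool" where
  "pointwise_kernel M U K P \<longleftrightarrow>
     (\<forall>q\<in>U. kernel_section U K q \<in> L2_space M) \<and>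
     (\<forall>f\<in>L2_space M. AE q in M. P f q = L2_inner M f (kernel_section U K q)) \<and>
     (\<forall>f\<in>L2_space M. \<forall>q\<in>U. value_at M U K (P f) q = L2_inner M f (kernel_section U K q))"

text \<open>
  The integral is over \<open>B \<inter> U\<close>, where the diagonal of \<open>K\<close> is meaningful; integrability is explicit
  because the Bochner integral of a non-integrable function is 0 by convention.
\<close>

definition diagonal_trace_formula ::
  "real measure \<Rightarrow> real set \<Rightarrow> (real \<Rightarrow> real \<Rightarrow> complex) \<Rightarrow>
   ((real \<Rightarrow> complex) \<Rightarrow> real \<Rightarrow> complex) \<Rightarrow> bool" where
  "diagonal_trace_formula M U K P \<longleftrightarrow>
     (\<forall>q\<in>U. L2_inner M (kernel_section U K q) (kernel_section U K q) = K q q) \<and>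
     (\<forall>B\<in>sets borel. bounded B \<longrightarrow>
        set_integrable M (B \<inter> U) (\<lambda>q. K q q) \<and>
        has_L2_trace M (compression B P) (LINT q:B \<inter> U|M. K q q))"

definition division_in_L2 ::
  "real measure \<Rightarrow> real set \<Rightarrow> (real \<Rightarrow> real \<Rightarrow> complex) \<Rightarrow> (real \<Rightarrow> complex) set \<Rightarrow> bool" where
  "division_in_L2 M U K L \<longleftrightarrow>
     (\<forall>q\<in>U. \<forall>\<phi>\<in>L. value_at M U K \<phi> q = 0 \<longrightarrow>
        (\<lambda>x. \<phi> x / complex_of_real (x - q)) \<in> L2_space M)"

definition continuous_case ::
  "real measure \<Rightarrow> bool" where
  "continuous_case M \<longleftrightarrow> (\<forall>p. emeasure M {p} = 0)"

definition discrete_case ::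
  "real measure \<Rightarrow> real set \<Rightarrow> bool" where
  "discrete_case M E \<longleftrightarrow>
     countable E \<and> (\<forall>x. \<not> x islimpt E) \<and> M = distr (count_space E) borel (\<lambda>x. x)"

end

theory Submission
  imports Defs
begin

text \<open>
  Write \<open>v\<^sub>q\<close> for the kernel section at \<open>q\<close> and \<open>\<phi>(q) = \<langle>\<phi>, v\<^sub>q\<rangle>\<close> for values of elements of \<open>L\<close>.  The
  quotient \<open>\<psi>(x) = \<phi>(x) / (x - p)\<close> is square integrable, by hypothesis in the continuous case and
  because \<open>p\<close> is isolated in the discrete one.  The point is how far \<open>\<psi>\<close> is from \<open>L\<close>.  An integrable
  kernel satisfies \<open>(t - q) v\<^sub>q(t) = D(t, q)\<close> with \<open>D(x, y) = A(x) B(y) - A(y) B(x)\<close>, so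
  \<open>\<phi>(q) - (q - p) \<langle>\<psi>, v\<^sub>q\<rangle> = \<integral> \<psi>(t) cnj D(t, q) d\<mu>(t)\<close>.  As a function of \<open>q\<close>, the right-hand side
  lies in the two-dimensional span of \<open>cnj A\<close> and \<open>cnj B\<close>, and it vanishes at \<open>q = p\<close>.  Hence it is a
  multiple of \<open>cnj D(p, q)\<close>, and off \<open>p\<close> the projection of \<open>\<psi>\<close> is \<open>\<psi>\<close> plus a multiple of
  \<open>cnj v\<^sub>p\<close> (\<open>division_formula\<close>).

  It remains to see that \<open>cnj v\<^sub>p\<close> is in \<open>L\<close>.  The kernel is symmetric because \<open>D\<close> is antisymmetric,
  and Hermitian because it is the kernel of a projection; so it is real, and \<open>L\<close> is invariant under
  conjugation (\<open>L_cnj\<close>).  This produces \<open>g \<in> L\<close> with \<open>\<phi>(x) = (x - p) g(x)\<close> almost everywhere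
  (\<open>division_AE\<close>).  In the discrete case this means everywhere on \<open>U\<close>.  In the continuous case \<open>U\<close>
  may have points outside the support of \<open>\<mu>\<close>, and these are reached by a second application of the
  division formula, to \<open>g\<close> itself (\<open>division_everywhere\<close>).
\<close>

section \<open>Square-integrable functions\<close>

lemma L2_space_AE_cong:
  assumes "f \<in> L2_space M" "g \<in> borel_measurable M" "AE x in M. f x = g x"
  shows "g \<in> L2_space M"
proof -
  have "integrable M (\<lambda>x. (cmod (g x))\<^sup>2)"
    by (rule integrable_cong_AE_imp[of M "\<lambda>x. (cmod (f x))\<^sup>2"])
       (use assms in \<open>auto simp: L2_space_def\<close>)
  with assms show ?thesis by (simp add: L2_space_def)
qed

lemma L2_space_cnj:
  assumes "f \<in> L2_space M"
  shows "(\<lambda>x. cnj (f x)) \<in> L2_space M"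
proof -
  have [measurable]: "f \<in> borel_measurable M" using assms by (simp add: L2_space_def)
  have "(\<lambda>x. cnj (f x)) \<in> borel_measurable M"
    by (rule borel_measurable_continuous_on[where f = cnj]) (auto intro: continuous_intros)
  then show ?thesis using assms by (simp add: L2_space_def)
qed

lemma L2_space_diff:
  assumes "f \<in> L2_space M" "g \<in> L2_space M"
  shows "(\<lambda>x. f x - g x) \<in> L2_space M"
proof -
  have [measurable]: "f \<in> borel_measurable M" "g \<in> borel_measurable M"
    using assms by (auto simp: L2_space_def)
  have i: "integrable M (\<lambda>x. 2 * (cmod (f x))\<^sup>2 + 2 * (cmod (g x))\<^sup>2)"
    using assms by (auto simp: L2_space_def)
  have "integrable M (\<lambda>x. (cmod (f x - g x))\<^sup>2)"
  proof (rule Bochner_Integration.integrable_bound[OF i])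
    show "AE x in M. norm ((cmod (f x - g x))\<^sup>2)
        \<le> norm (2 * (cmod (f x))\<^sup>2 + 2 * (cmod (g x))\<^sup>2)"
    proof (rule AE_I2)
      fix x
      let ?a = "cmod (f x)" and ?b = "cmod (g x)"
      have "(cmod (f x - g x))\<^sup>2 \<le> (?a + ?b)\<^sup>2"
        by (intro power_mono norm_triangle_ineq4) auto
      also have "\<dots> \<le> 2 * ?a\<^sup>2 + 2 * ?b\<^sup>2"
        using sum_squares_bound[of ?a ?b] by (simp add: power2_sum)
      finally show "norm ((cmod (f x - g x))\<^sup>2) \<le> norm (2 * ?a\<^sup>2 + 2 * ?b\<^sup>2)" by simp
    qed
  qed measurable
  then show ?thesis by (simp add: L2_space_def)
qed

lemma L2_space_dominated:
  assumes "f \<in> L2_space M" "g \<in> borel_measurable M" "AE x in M. cmod (g x) \<le> c * cmod (f x)"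
  shows "g \<in> L2_space M"
proof -
  have "integrable M (\<lambda>x. (cmod (g x))\<^sup>2)"
  proof (rule Bochner_Integration.integrable_bound)
    show "integrable M (\<lambda>x. c\<^sup>2 * (cmod (f x))\<^sup>2)" using assms(1) by (simp add: L2_space_def)
    show "AE x in M. norm ((cmod (g x))\<^sup>2) \<le> norm (c\<^sup>2 * (cmod (f x))\<^sup>2)"
      using assms(3)
    proof eventually_elim
      case (elim x)
      then have "(cmod (g x))\<^sup>2 \<le> (c * cmod (f x))\<^sup>2" by (intro power_mono) auto
      then show ?case by (simp add: power_mult_distrib)
    qed
  qed (use assms in auto)
  with assms(2) show ?thesis by (simp add: L2_space_def)
qed

lemma integrable_L2_inner:
  assumes "f \<in> L2_space M" "g \<in> L2_space M"
  shows "integrable M (\<lambda>x. f x * cnj (g x))"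
proof (rule Bochner_Integration.integrable_bound)
  show "integrable M (\<lambda>x. (cmod (f x))\<^sup>2 + (cmod (g x))\<^sup>2)"
    using assms by (auto simp: L2_space_def)
  show "(\<lambda>x. f x * cnj (g x)) \<in> borel_measurable M"
    using assms L2_space_cnj[OF assms(2)] by (auto simp: L2_space_def)
  show "AE x in M. norm (f x * cnj (g x)) \<le> norm ((cmod (f x))\<^sup>2 + (cmod (g x))\<^sup>2)"
  proof (rule AE_I2)
    fix x
    have "2 * (cmod (f x) * cmod (g x)) \<le> (cmod (f x))\<^sup>2 + (cmod (g x))\<^sup>2"
      using sum_squares_bound[of "cmod (f x)" "cmod (g x)"] by (simp add: mult.assoc)
    moreover have "0 \<le> cmod (f x) * cmod (g x)" by simp
    ultimately show "norm (f x * cnj (g x)) \<le> norm ((cmod (f x))\<^sup>2 + (cmod (g x))\<^sup>2)"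
      unfolding norm_mult complex_mod_cnj real_norm_def by linarith
  qed
qed

lemma L2_inner_diff_left:
  assumes "f \<in> L2_space M" "g \<in> L2_space M" "h \<in> L2_space M"
  shows "L2_inner M (\<lambda>x. f x - g x) h = L2_inner M f h - L2_inner M g h"
  using integrable_L2_inner[OF assms(1,3)] integrable_L2_inner[OF assms(2,3)]
  by (simp add: L2_inner_def left_diff_distrib)

lemma L2_inner_diff_right:
  assumes "f \<in> L2_space M" "g \<in> L2_space M" "h \<in> L2_space M"
  shows "L2_inner M h (\<lambda>x. f x - g x) = L2_inner M h f - L2_inner M h g"
  using integrable_L2_inner[OF assms(3,1)] integrable_L2_inner[OF assms(3,2)]
  by (simp add: L2_inner_def right_diff_distrib)

lemma L2_inner_commute: "L2_inner M g f = cnj (L2_inner M f g)"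
  unfolding L2_inner_def Bochner_Integration.integral_cnj[symmetric]
  by (simp add: mult.commute del: Bochner_Integration.integral_cnj)

lemma L2_inner_self_eq_0_imp_AE:
  assumes "f \<in> L2_space M" "L2_inner M f f = 0"
  shows "AE x in M. f x = 0"
proof -
  have "L2_inner M f f = complex_of_real (LINT x|M. (cmod (f x))\<^sup>2)"
    unfolding L2_inner_def complex_norm_square[symmetric] by (rule integral_complex_of_real)
  with assms have "(LINT x|M. (cmod (f x))\<^sup>2) = 0" by simp
  with assms(1) have "AE x in M. (cmod (f x))\<^sup>2 = 0"
    by (subst (asm) integral_nonneg_eq_0_iff_AE) (auto simp: L2_space_def)
  then show ?thesis by simp
qed

section \<open>Projections with an integrable kernel\<close>

locale integrable_kernel_projection =
  fixes M :: "real measure"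
    and L :: "(real \<Rightarrow> complex) set"
    and P :: "(real \<Rightarrow> complex) \<Rightarrow> real \<Rightarrow> complex"
    and K :: "real \<Rightarrow> real \<Rightarrow> complex"
    and U :: "real set"
    and A B :: "real \<Rightarrow> complex"
  assumes sets_M: "sets M = sets borel"
    and closed_L: "closed_L2_subspace M L"
    and projection: "L2_orth_projection M L P"
    and null_compl: "- U \<in> null_sets M"
    and kernel: "pointwise_kernel M U K P"
    and off_diag: "integrable_kernel_off_diag U A B K"
    and indep: "lin_indep_on U A B"
    and nonvanishing: "\<And>x. x \<in> U \<Longrightarrow> \<not> (A x = 0 \<and> B x = 0)"
begin

abbreviation v :: "real \<Rightarrow> real \<Rightarrow> complex" where
  "v \<equiv> kernel_section U K"

lemma AE_in_U: "AE x in M. x \<in> U"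
  using AE_not_in[OF null_compl] by simp

lemma L_sub: "f \<in> L \<Longrightarrow> f \<in> L2_space M"
  by (rule closed_L[unfolded closed_L2_subspace_def, THEN conjunct1, THEN subsetD])

lemma L_zero: "(\<lambda>x. 0) \<in> L"
  by (rule closed_L[unfolded closed_L2_subspace_def, THEN conjunct2, THEN conjunct1])

lemma L_add: "f \<in> L \<Longrightarrow> g \<in> L \<Longrightarrow> (\<lambda>x. f x + g x) \<in> L"
  by (rule closed_L[unfolded closed_L2_subspace_def, THEN conjunct2, THEN conjunct2, THEN conjunct1,
        rule_format])

lemma L_scale: "f \<in> L \<Longrightarrow> (\<lambda>x. c * f x) \<in> L"
  by (rule closed_L[unfolded closed_L2_subspace_def, THEN conjunct2, THEN conjunct2, THEN conjunct2,
        THEN conjunct1, rule_format])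

lemma L_diff:
  assumes "f \<in> L" "g \<in> L"
  shows "(\<lambda>x. f x - g x) \<in> L"
  using L_add[OF assms(1) L_scale[OF assms(2), of "-1"]] by simp

text \<open>The constant sequence \<open>f\<close> converges to every \<open>g\<close> that agrees with \<open>f\<close> almost everywhere.\<close>

lemma L_AE_cong:
  assumes "f \<in> L" "g \<in> borel_measurable M" "AE x in M. f x = g x"
  shows "g \<in> L"
proof -
  have f: "f \<in> L2_space M" by (rule L_sub[OF assms(1)])
  have g: "g \<in> L2_space M" by (rule L2_space_AE_cong[OF f assms(2,3)])
  have "(LINT x|M. (cmod (f x - g x))\<^sup>2) = 0"
    by (rule integral_eq_zero_AE) (use assms(3) in auto)
  then have "L2_nrm M (\<lambda>x. f x - g x) = 0" by (simp add: L2_nrm_def)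
  moreover have "\<forall>s g. (\<forall>n::nat. s n \<in> L) \<longrightarrow> g \<in> L2_space M \<longrightarrow>
      (\<lambda>n. L2_nrm M (\<lambda>x. s n x - g x)) \<longlonglongrightarrow> 0 \<longrightarrow> g \<in> L"
    using closed_L unfolding closed_L2_subspace_def by (elim conjE)
  from this[rule_format, of "\<lambda>n. f" g] have "L2_nrm M (\<lambda>x. f x - g x) = 0 \<Longrightarrow> g \<in> L"
    using assms(1) g by simp
  ultimately show ?thesis by blast
qed

lemma P_in_L: "f \<in> L2_space M \<Longrightarrow> P f \<in> L"
  by (rule projection[unfolded L2_orth_projection_def, rule_format, THEN conjunct1])

lemma P_orth: "f \<in> L2_space M \<Longrightarrow> g \<in> L \<Longrightarrow> L2_inner M (\<lambda>x. f x - P f x) g = 0"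
  by (rule projection[unfolded L2_orth_projection_def, rule_format, THEN conjunct2, rule_format])

lemma P_fixes_L:
  assumes "f \<in> L"
  shows "AE x in M. P f x = f x"
proof -
  have f: "f \<in> L2_space M" by (rule L_sub[OF assms])
  have d: "(\<lambda>x. f x - P f x) \<in> L" by (rule L_diff[OF assms P_in_L[OF f]])
  have "AE x in M. f x - P f x = 0"
    by (rule L2_inner_self_eq_0_imp_AE[OF L_sub[OF d] P_orth[OF f d]])
  then show ?thesis by eventually_elim simp
qed

lemma v_L2: "q \<in> U \<Longrightarrow> v q \<in> L2_space M"
  by (rule kernel[unfolded pointwise_kernel_def, THEN conjunct1, rule_format])

lemma P_AE: "f \<in> L2_space M \<Longrightarrow> AE q in M. P f q = L2_inner M f (v q)"
  by (rule kernel[unfolded pointwise_kernel_def, THEN conjunct2, THEN conjunct1, rule_format])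

lemma P_value: "f \<in> L2_space M \<Longrightarrow> q \<in> U \<Longrightarrow> L2_inner M (P f) (v q) = L2_inner M f (v q)"
  by (rule kernel[unfolded pointwise_kernel_def value_at_def, THEN conjunct2, THEN conjunct2,
        rule_format])

lemma value_at_AE:
  assumes "f \<in> L"
  shows "AE q in M. value_at M U K f q = f q"
  using P_AE[OF L_sub[OF assms]] P_fixes_L[OF assms]
  by eventually_elim (simp add: value_at_def)

text \<open>
  The identity \<open>\<langle>P f, v\<^sub>q\<rangle> = \<langle>f, v\<^sub>q\<rangle>\<close> at \<open>f = v\<^sub>q\<close> says that \<open>v\<^sub>q - P v\<^sub>q\<close> is orthogonal to \<open>v\<^sub>q\<close>.  It is
  also orthogonal to \<open>P v\<^sub>q \<in> L\<close>, hence to itself.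
\<close>

lemma v_in_L:
  assumes q: "q \<in> U"
  shows "v q \<in> L"
proof -
  let ?u = "\<lambda>x. v q x - P (v q) x"
  have Pv: "P (v q) \<in> L" by (rule P_in_L[OF v_L2[OF q]])
  have "?u \<in> L2_space M" by (rule L2_space_diff[OF v_L2[OF q] L_sub[OF Pv]])
  moreover have "L2_inner M ?u ?u = 0"
  proof -
    have "L2_inner M ?u ?u = L2_inner M ?u (v q) - L2_inner M ?u (P (v q))"
      by (rule L2_inner_diff_right[OF v_L2[OF q] L_sub[OF Pv] \<open>?u \<in> L2_space M\<close>])
    also have "L2_inner M ?u (P (v q)) = 0" by (rule P_orth[OF v_L2[OF q] Pv])
    also have "L2_inner M ?u (v q) = L2_inner M (v q) (v q) - L2_inner M (P (v q)) (v q)"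
      by (rule L2_inner_diff_left[OF v_L2[OF q] L_sub[OF Pv] v_L2[OF q]])
    finally show ?thesis using P_value[OF v_L2[OF q] q] by simp
  qed
  ultimately have "AE x in M. ?u x = 0" by (rule L2_inner_self_eq_0_imp_AE)
  then have "AE x in M. P (v q) x = v q x" by eventually_elim simp
  then show ?thesis using L_AE_cong[OF Pv] v_L2[OF q] by (simp add: L2_space_def)
qed

section \<open>Reality of the kernel and conjugation invariance\<close>

definition wedge :: "real \<Rightarrow> real \<Rightarrow> complex" where
  "wedge x y = A x * B y - A y * B x"

lemma v_wedge: "x \<in> U \<Longrightarrow> q \<in> U \<Longrightarrow> of_real (x - q) * v q x = wedge x q"
  using off_diag
  by (cases "x = q") (auto simp: integrable_kernel_off_diag_def kernel_section_def wedge_def)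

lemma kernel_sym:
  assumes "x \<in> U" "y \<in> U"
  shows "v x y = v y x"
proof (cases "x = y")
  case False
  have "of_real (y - x) * v x y = - (of_real (x - y) * v y x)"
    unfolding v_wedge[OF assms] v_wedge[OF assms(2,1)] by (simp add: wedge_def)
  also have "\<dots> = of_real (y - x) * v y x" by (simp add: algebra_simps)
  finally show ?thesis using False by (simp del: of_real_diff)
qed simp

text \<open>
  Symmetry turns the Hermitian symmetry of a projection kernel into reality.  The Hermitian symmetry
  itself is only available almost everywhere: \<open>v\<^sub>y\<close> is an element of \<open>L\<close>, so for each fixed \<open>y\<close> its
  value \<open>H(x, y) = \<langle>v\<^sub>y, v\<^sub>x\<rangle>\<close> at \<open>x\<close> is \<open>K(x, y)\<close> for almost every \<open>x\<close>, and \<open>H(x, y)\<close> is the conjugate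
  of \<open>H(y, x)\<close>.  To compare the two, Fubini exchanges the roles of \<open>x\<close> and \<open>y\<close>; this is why \<open>A\<close> and
  \<open>B\<close> have to be measurable here.
\<close>

lemma kernel_real_no_atoms:
  assumes "sigma_finite_measure M" and no_atoms: "\<forall>x. AE t in M. t \<noteq> x"
    and "open U" "continuous_on U A" "continuous_on U B"
  shows "AE q in M. AE x in M. cnj (v q x) = v q x"
proof -
  interpret sigma_finite_measure M by fact
  interpret pair_sigma_finite M M ..
  define a where "a x = (if x \<in> U then A x else 0)" for x
  define b where "b x = (if x \<in> U then B x else 0)" for x
  note [measurable_cong] = sets_M
  have [measurable]: "a \<in> borel_measurable borel" "b \<in> borel_measurable borel"
    unfolding a_def b_def using assms(3-5)
    by (auto intro!: borel_measurable_continuous_on_if)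
  have [measurable]: "cnj \<in> borel_measurable borel"
    by (intro borel_measurable_continuous_onI continuous_intros)
  (* A total measurable version of the kernel; division by zero makes it 0 on the diagonal, which
     is a null set in each variable. *)
  define k where "k y x = (a x * b y - a y * b x) / of_real (x - y)" for x y
  have [measurable]: "(\<lambda>(y, x). k y x) \<in> borel_measurable (borel \<Otimes>\<^sub>M borel)"
    unfolding k_def by measurable
  have k_v: "AE x in M. k y x = v y x" if "y \<in> U" for y
    using no_atoms[rule_format, of y]
  proof eventually_elim
    case (elim x)
    then show ?case using that off_diag
      by (auto simp: k_def a_def b_def kernel_section_def integrable_kernel_off_diag_def)
  qed
  define H where "H x y = (LINT t|M. k y t * cnj (k x t))" for x y
  have [measurable]: "(\<lambda>(x, y). H x y) \<in> borel_measurable (M \<Otimes>\<^sub>M M)"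
    unfolding H_def split_def by measurable
  have H: "AE x in M. H x y = k y x" if y: "y \<in> U" for y
    using value_at_AE[OF v_in_L[OF y]] AE_in_U k_v[OF y]
  proof eventually_elim
    case (elim x)
    have "H x y = value_at M U K (v y) x"
      unfolding H_def value_at_def L2_inner_def
    proof (rule integral_cong_AE)
      show "AE t in M. k y t * cnj (k x t) = v y t * cnj (v x t)"
        using k_v[OF y] k_v[OF elim(2)] by eventually_elim simp
      show "(\<lambda>t. v y t * cnj (v x t)) \<in> borel_measurable M"
        using integrable_L2_inner[OF v_L2[OF y] v_L2[OF elim(2)]] by auto
    qed measurable
    with elim show ?case by simp
  qed
  have "AE y in M. AE x in M. H x y = k y x"
    using AE_in_U by eventually_elim (rule H)
  then have "AE x in M. AE y in M. H x y = k y x"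
    by (subst AE_commute) measurable
  then show ?thesis
    using AE_in_U
  proof eventually_elim
    case (elim x)
    show ?case using elim(1) H[OF elim(2)] k_v[OF elim(2)]
    proof eventually_elim
      case (elim y)
      have "H x y = cnj (H y x)"
        unfolding H_def Bochner_Integration.integral_cnj[symmetric]
        by (simp add: mult.commute del: Bochner_Integration.integral_cnj)
      moreover have "k y x = k x y"
      proof -
        have "k y x = - (a x * b y - a y * b x) / - of_real (x - y)"
          by (simp only: k_def minus_divide_divide)
        then show ?thesis by (simp add: k_def algebra_simps)
      qed
      ultimately show ?case using elim by simp
    qed
  qed
qed

text \<open>
  If \<open>M\<close> charges every point of \<open>U\<close>, the identity \<open>\<langle>v\<^sub>q, v\<^sub>x\<rangle> = K(x, q)\<close> holds at every pair of points,
  the diagonal included, and Hermitian symmetry is immediate.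
\<close>

lemma kernel_real_atoms:
  assumes everywhere: "\<forall>Q. (AE t in M. Q t) \<longrightarrow> (\<forall>x\<in>U. Q x)"
  shows "AE q in M. AE x in M. cnj (v q x) = v q x"
proof -
  have repr: "L2_inner M (v q) (v x) = v q x" if "q \<in> U" "x \<in> U" for q x
    using everywhere value_at_AE[OF v_in_L[OF that(1)]] that(2)
    unfolding value_at_def by blast
  have "cnj (v q x) = v q x" if "q \<in> U" "x \<in> U" for q x
    using repr[OF that] repr[OF that(2,1)] kernel_sym[OF that] L2_inner_commute[of M "v q" "v x"]
    by simp
  note cnj_v = this
  show ?thesis
    using AE_in_U
  proof eventually_elim
    case (elim q)
    show ?case using AE_in_U by eventually_elim (rule cnj_v[OF elim])
  qed
qed

text \<open>
  A real kernel makes the projection commute with conjugation, because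
  \<open>P (cnj f) (q) = \<langle>cnj f, v\<^sub>q\<rangle> = cnj \<langle>f, v\<^sub>q\<rangle>\<close> as soon as \<open>v\<^sub>q\<close> is real.  The use of this is that
  \<open>cnj v\<^sub>p\<close> lies in \<open>L\<close> for every \<open>p \<in> U\<close>, although \<open>v\<^sub>p\<close> itself is known to be real only for
  almost every \<open>p\<close>.
\<close>

lemma L_cnj:
  assumes real: "AE q in M. AE x in M. cnj (v q x) = v q x" and f: "f \<in> L"
  shows "(\<lambda>x. cnj (f x)) \<in> L"
proof -
  let ?g = "\<lambda>x. cnj (f x)"
  have g: "?g \<in> L2_space M" by (rule L2_space_cnj[OF L_sub[OF f]])
  have "AE q in M. P ?g q = ?g q"
    using P_AE[OF g] value_at_AE[OF f] real AE_in_U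
  proof eventually_elim
    case (elim q)
    have v: "v q \<in> borel_measurable M" "(\<lambda>x. cnj (v q x)) \<in> borel_measurable M"
      using v_L2[OF elim(4)] L2_space_cnj[OF v_L2[OF elim(4)]] by (auto simp: L2_space_def)
    have m: "f \<in> borel_measurable M" "?g \<in> borel_measurable M"
      using L_sub[OF f] g by (auto simp: L2_space_def)
    have "P ?g q = (LINT x|M. cnj (f x) * cnj (v q x))"
      using elim(1) by (simp add: L2_inner_def)
    also have "\<dots> = (LINT x|M. cnj (f x * cnj (v q x)))"
    proof (rule integral_cong_AE)
      show "AE x in M. cnj (f x) * cnj (v q x) = cnj (f x * cnj (v q x))"
        using elim(3) by eventually_elim simp
    qed (use m v in auto)
    also have "\<dots> = cnj (value_at M U K f q)"
      by (simp only: Bochner_Integration.integral_cnj value_at_def L2_inner_def)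
    finally show ?case using elim(2) by simp
  qed
  then show ?thesis using L_AE_cong[OF P_in_L[OF g]] g by (simp add: L2_space_def)
qed

section \<open>Division by a linear factor\<close>

lemma wedge_pluecker: "wedge t q * wedge p r = wedge t p * wedge q r + wedge t r * wedge p q"
  by (simp add: wedge_def algebra_simps)

lemma wedge_nonzero:
  assumes "p \<in> U"
  obtains r where "r \<in> U" "wedge p r \<noteq> 0"
proof (rule ccontr)
  assume "\<not> thesis"
  then have "\<forall>x\<in>U. (- B p) * A x + A p * B x = 0"
    using that by (auto simp: wedge_def algebra_simps)
  then have "- B p = 0 \<and> A p = 0"
    using indep unfolding lin_indep_on_def by blast
  then show False using nonvanishing[OF assms] by simp
qed

text \<open>
  Subtracting \<open>(q - p) \<langle>\<psi>, v\<^sub>q\<rangle>\<close> from \<open>\<phi>(q) = \<langle>(t - p) \<psi>, v\<^sub>q\<rangle>\<close> leaves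
  \<open>J(q) = \<langle>\<psi>, (t - q) v\<^sub>q\<rangle> = \<integral> \<psi>(t) cnj (wedge t q) dM(t)\<close>.  The functions \<open>\<psi> A\<close> and \<open>\<psi> B\<close> need not be
  treated separately: the Pluecker relation expresses \<open>J(q)\<close> through \<open>J(p)\<close> and \<open>J(r)\<close>
  whenever \<open>wedge p r\<close> is nonzero.  Since \<open>J(p) = \<phi>(p) = 0\<close>, it follows that \<open>J(q)\<close> is a constant
  multiple of \<open>cnj (wedge p q)\<close>, that is of \<open>(q - p) cnj v\<^sub>p(q)\<close>.
\<close>

lemma division_formula:
  assumes p: "p \<in> U" and \<phi>: "\<phi> \<in> L2_space M" "value_at M U K \<phi> p = 0"
    and \<psi>: "\<psi> \<in> L2_space M" and div: "AE t in M. of_real (t - p) * \<psi> t = \<phi> t"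
  obtains c where "\<And>q. q \<in> U \<Longrightarrow> of_real (q - p) * value_at M U K \<psi> q
      = value_at M U K \<phi> q + c * of_real (q - p) * cnj (v p q)"
proof -
  define J where "J q = value_at M U K \<phi> q - of_real (q - p) * value_at M U K \<psi> q" for q
  have J: "has_bochner_integral M (\<lambda>t. \<phi> t * cnj (v q t) - of_real (q - p) * (\<psi> t * cnj (v q t))) (J q)"
    if q: "q \<in> U" for q
    unfolding J_def value_at_def L2_inner_def
    by (intro has_bochner_integral_diff has_bochner_integral_mult_right
        has_bochner_integral_integrable integrable_L2_inner \<phi>(1) \<psi> v_L2 q)
  have J_integrand: "AE t in M. \<phi> t * cnj (v q t) - of_real (q - p) * (\<psi> t * cnj (v q t))
      = \<psi> t * cnj (wedge t q)" if q: "q \<in> U" for q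
    using div AE_in_U
  proof eventually_elim
    case (elim t)
    show ?case unfolding v_wedge[OF elim(2) q, symmetric] elim(1)[symmetric]
      by (simp add: algebra_simps)
  qed
  obtain r where r: "r \<in> U" "wedge p r \<noteq> 0" using wedge_nonzero[OF p] .
  have J_lin: "J q * cnj (wedge p r) = J p * cnj (wedge q r) + J r * cnj (wedge p q)"
    if q: "q \<in> U" for q
  proof -
    let ?I = "\<lambda>q t. \<phi> t * cnj (v q t) - of_real (q - p) * (\<psi> t * cnj (v q t))"
    have 1: "has_bochner_integral M (\<lambda>t. ?I q t * cnj (wedge p r)) (J q * cnj (wedge p r))"
      by (intro has_bochner_integral_mult_left J q)
    have 2: "has_bochner_integral M (\<lambda>t. ?I p t * cnj (wedge q r) + ?I r t * cnj (wedge p q))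
        (J p * cnj (wedge q r) + J r * cnj (wedge p q))"
      by (intro has_bochner_integral_add has_bochner_integral_mult_left J p r)
    have "AE t in M. ?I q t * cnj (wedge p r)
        = ?I p t * cnj (wedge q r) + ?I r t * cnj (wedge p q)"
      using J_integrand[OF q] J_integrand[OF p] J_integrand[OF r(1)]
    proof eventually_elim
      case (elim t)
      show ?case unfolding elim
        using arg_cong[OF wedge_pluecker[of t q p r], of "\<lambda>z. \<psi> t * cnj z"]
        by (simp add: algebra_simps)
    qed
    then have "(LINT t|M. ?I q t * cnj (wedge p r))
        = (LINT t|M. ?I p t * cnj (wedge q r) + ?I r t * cnj (wedge p q))"
      by (intro integral_cong_AE borel_measurable_has_bochner_integral[OF 1]
          borel_measurable_has_bochner_integral[OF 2])
    then show ?thesis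
      by (simp only: has_bochner_integral_integral_eq[OF 1] has_bochner_integral_integral_eq[OF 2])
  qed
  have Jp: "J p = 0" by (simp add: J_def \<phi>(2))
  define c where "c = J r / cnj (wedge p r)"
  show thesis
  proof (rule that)
    fix q assume q: "q \<in> U"
    have "J q = c * cnj (wedge p q)"
      using J_lin[OF q] Jp r(2) by (simp add: c_def field_simps)
    also have "wedge p q = - (of_real (q - p) * v p q)"
      unfolding v_wedge[OF q p] by (simp add: wedge_def)
    finally have "J q = - (c * of_real (q - p) * cnj (v p q))" by simp
    then show "of_real (q - p) * value_at M U K \<psi> q
      = value_at M U K \<phi> q + c * of_real (q - p) * cnj (v p q)"
      unfolding J_def by algebra
  qed
qed

text \<open>
  By the division formula, \<open>P \<psi>\<close> and \<open>\<psi>\<close> differ almost everywhere off \<open>p\<close> by a multiple of \<open>cnj v\<^sub>p\<close>, which belongs to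
  \<open>L\<close>.  Removing it from \<open>P \<psi>\<close> gives the quotient; if \<open>p\<close> is an atom, its value at \<open>p\<close> may differ from
  \<open>\<psi>(p)\<close>, which is harmless because \<open>\<phi>(p) = 0\<close>.
\<close>

lemma division_AE:
  assumes real: "AE q in M. AE x in M. cnj (v q x) = v q x"
    and p: "p \<in> U" and \<phi>: "\<phi> \<in> L" "value_at M U K \<phi> p = 0"
    and \<psi>: "\<psi> \<in> L2_space M" and div: "AE t in M. of_real (t - p) * \<psi> t = \<phi> t"
  obtains g where "g \<in> L" "AE t in M. of_real (t - p) * g t = \<phi> t"
proof -
  obtain c where c: "\<And>q. q \<in> U \<Longrightarrow> of_real (q - p) * value_at M U K \<psi> q
      = value_at M U K \<phi> q + c * of_real (q - p) * cnj (v p q)"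
    using division_formula[OF p L_sub[OF \<phi>(1)] \<phi>(2) \<psi> div] by blast
  let ?g = "\<lambda>t. P \<psi> t - c * cnj (v p t)"
  have "?g \<in> L"
    by (intro L_diff P_in_L \<psi> L_scale L_cnj real v_in_L p)
  moreover have "AE t in M. of_real (t - p) * ?g t = \<phi> t"
    using P_AE[OF \<psi>] value_at_AE[OF \<phi>(1)] AE_in_U
  proof eventually_elim
    case (elim t)
    with c[OF elim(3)] show ?case by (simp add: value_at_def algebra_simps)
  qed
  ultimately show thesis by (rule that)
qed

text \<open>
  Almost every point of \<open>U\<close> is not enough: \<open>U\<close> may contain points outside the support of \<open>M\<close>.  The
  division formula, applied once more with the quotient \<open>g \<in> L\<close> in place of \<open>\<psi>\<close>, holds at all points
  of \<open>U\<close>, with an error term \<open>c (q - p) cnj v\<^sub>p(q)\<close> that vanishes for almost every \<open>q\<close>.  Either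
  \<open>c = 0\<close> and there is no error at all, or \<open>wedge q p\<close> vanishes for almost every \<open>q\<close>.  In the latter
  case \<open>(A, B)\<close> is almost everywhere parallel to the nonzero vector \<open>(A p, B p)\<close>, so that almost all
  \<open>v\<^sub>q\<close> vanish almost everywhere off \<open>q\<close>; without atoms this leaves only \<open>\<phi> = 0\<close>.
\<close>

lemma division_everywhere:
  assumes real: "AE q in M. AE x in M. cnj (v q x) = v q x"
    and points: "(\<forall>x. AE t in M. t \<noteq> x) \<or> (\<forall>Q. (AE t in M. Q t) \<longrightarrow> (\<forall>x\<in>U. Q x))"
    and p: "p \<in> U" and \<phi>: "\<phi> \<in> L" "value_at M U K \<phi> p = 0"
    and \<psi>: "\<psi> \<in> L2_space M" and div: "AE t in M. of_real (t - p) * \<psi> t = \<phi> t"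
  shows "\<exists>g\<in>L. \<forall>x\<in>U. value_at M U K \<phi> x = of_real (x - p) * value_at M U K g x"
proof -
  obtain g where g: "g \<in> L" "AE t in M. of_real (t - p) * g t = \<phi> t"
    using division_AE[OF real p \<phi> \<psi> div] .
  obtain c where c: "\<And>q. q \<in> U \<Longrightarrow> of_real (q - p) * value_at M U K g q
      = value_at M U K \<phi> q + c * of_real (q - p) * cnj (v p q)"
    using division_formula[OF p L_sub[OF \<phi>(1)] \<phi>(2) L_sub[OF g(1)] g(2)] by blast
  have AE0: "AE q in M. c * wedge q p = 0"
    using value_at_AE[OF g(1)] value_at_AE[OF \<phi>(1)] g(2) AE_in_U
  proof eventually_elim
    case (elim q)
    then have "c * of_real (q - p) * cnj (v p q) = 0" using c[OF elim(4)] by simp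
    then show ?case unfolding v_wedge[OF elim(4) p, symmetric] by auto
  qed
  have cz: "\<exists>g\<in>L. \<forall>x\<in>U. value_at M U K \<phi> x = of_real (x - p) * value_at M U K g x"
    if "\<forall>q\<in>U. c * wedge q p = 0"
  proof (intro bexI[OF _ g(1)] ballI)
    fix q assume q: "q \<in> U"
    have "c * of_real (q - p) * cnj (v p q) = 0"
      using that q v_wedge[OF q p] by (auto simp del: of_real_diff)
    then show "value_at M U K \<phi> q = of_real (q - p) * value_at M U K g q"
      using c[OF q] by simp
  qed
  show ?thesis
  proof (cases "c = 0")
    case True
    then show ?thesis using cz by simp
  next
    case False
    show ?thesis using points
    proof
      assume "\<forall>Q. (AE t in M. Q t) \<longrightarrow> (\<forall>x\<in>U. Q x)"
      then show ?thesis using cz AE0 by blast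
    next
      assume no_atoms: "\<forall>x. AE t in M. t \<noteq> x"
      have w0: "AE q in M. wedge q p = 0" using AE0 False by simp
      have "AE q in M. \<phi> q = 0"
        using value_at_AE[OF \<phi>(1)] AE_in_U w0
      proof eventually_elim
        case (elim q)
        have "AE t in M. \<phi> t * cnj (v q t) = 0"
          using w0 AE_in_U no_atoms[rule_format, of q]
        proof eventually_elim
          case (elim t)
          (* Both wedge t q * A p and wedge t q * B p are combinations of wedge q p and wedge t p. *)
          have "wedge t q * A p = A t * (A p * B q - A q * B p) + A q * (A t * B p - A p * B t)"
            "wedge t q * B p = B q * (A t * B p - A p * B t) + B t * (A p * B q - A q * B p)"
            by (auto simp: wedge_def algebra_simps)
          then have "wedge t q = 0"
            using nonvanishing[OF p] \<open>wedge q p = 0\<close> elim(1) by (auto simp: wedge_def)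
          then show ?case
            using v_wedge[OF elim(2) \<open>q \<in> U\<close>] elim(3) by simp
        qed
        then have "value_at M U K \<phi> q = 0"
          unfolding value_at_def L2_inner_def by (rule integral_eq_zero_AE)
        with elim(1) show ?case by simp
      qed
      then have "value_at M U K \<phi> q = 0" for q
        unfolding value_at_def L2_inner_def
        by (intro integral_eq_zero_AE) (auto elim: eventually_mono)
      moreover have "value_at M U K (\<lambda>x. 0) q = 0" for q
        by (simp add: value_at_def L2_inner_def)
      ultimately show ?thesis by (intro bexI[OF _ L_zero]) simp
    qed
  qed
qed

end

section \<open>Counting measure on a discrete set\<close>

lemma discrete_case_AE_imp:
  assumes "discrete_case M E" "AE t in M. Q t" "x \<in> E"
  shows "Q x"
proof (rule ccontr)
  assume "\<not> Q x"
  have M: "M = distr (count_space E) borel (\<lambda>x. x)"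
    using assms(1) by (simp add: discrete_case_def)
  have "emeasure M {x} = emeasure (count_space E) {x}"
    using assms(3) unfolding M by (subst emeasure_distr) (auto simp: Int_absorb2)
  also have "\<dots> = 1" using assms(3) by (subst emeasure_count_space_finite) auto
  finally have "emeasure M {x} = 1" .
  moreover obtain N where N: "{t \<in> space M. \<not> Q t} \<subseteq> N" "emeasure M N = 0" "N \<in> sets M"
    using AE_E[OF assms(2)] by blast
  ultimately show False
    using emeasure_mono[of "{x}" N M] \<open>\<not> Q x\<close> by (auto simp: M)
qed

text \<open>
  As \<open>p\<close> is not an accumulation point, \<open>\<bar>x - p\<bar>\<close> is bounded below on \<open>E - {p}\<close>; at \<open>x = p\<close> the quotient
  is \<open>0\<close> by convention.
\<close>

lemma discrete_case_divide_L2: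
  assumes M: "discrete_case M E" "AE x in M. x \<in> E" and f: "f \<in> L2_space M"
  shows "(\<lambda>x. f x / complex_of_real (x - p)) \<in> L2_space M"
proof -
  have "\<not> p islimpt E" using M by (simp add: discrete_case_def)
  then obtain e where e: "e > 0" "\<And>x. x \<in> E \<Longrightarrow> x \<noteq> p \<Longrightarrow> e \<le> \<bar>x - p\<bar>"
    unfolding islimpt_approachable dist_real_def by force
  have [measurable_cong]: "sets M = sets borel" using M(1) by (simp add: discrete_case_def)
  have [measurable]: "f \<in> borel_measurable M" using f by (simp add: L2_space_def)
  show ?thesis
  proof (rule L2_space_dominated[OF f, where c = "1 / e"])
    show "AE x in M. cmod (f x / complex_of_real (x - p)) \<le> 1 / e * cmod (f x)"
      using M(2)
    proof eventually_elim
      case (elim x)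
      show ?case
      proof (cases "x = p")
        case False
        then have "cmod (f x) / \<bar>x - p\<bar> \<le> cmod (f x) / e"
          using e elim by (intro divide_left_mono) auto
        then show ?thesis by (simp add: norm_divide del: of_real_diff)
      qed (use e in simp)
    qed
  qed measurable
qed

section \<open>Division in the subspace\<close>

theorem proposition1p2:
  fixes \<mu> :: "real measure"
    and L :: "(real \<Rightarrow> complex) set"
    and P :: "(real \<Rightarrow> complex) \<Rightarrow> real \<Rightarrow> complex"
    and K :: "real \<Rightarrow> real \<Rightarrow> complex"
    and U :: "real set"
    and p :: real
    and \<phi> :: "real \<Rightarrow> complex"
  assumes "sets \<mu> = sets borel"
    and "sigma_finite_measure \<mu>"
    and "closed_L2_subspace \<mu> L"
    and "L2_orth_projection \<mu> L P"
    and "locally_trace_class \<mu> P"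
    and "- U \<in> null_sets \<mu>"
    and "pointwise_kernel \<mu> U K P"
    and "diagonal_trace_formula \<mu> U K P"
    and "(continuous_case \<mu> \<and> integrable_kernel_continuous U K \<and> division_in_L2 \<mu> U K L) \<or>
         (discrete_case \<mu> U \<and> integrable_kernel_discrete U K)"
    and "p \<in> U"
    and "\<phi> \<in> L"
    and "value_at \<mu> U K \<phi> p = 0"
  shows "\<exists>\<psi>\<in>L. \<forall>x\<in>U. value_at \<mu> U K \<phi> x = complex_of_real (x - p) * value_at \<mu> U K \<psi> x"
  using assms(9)
proof (elim disjE conjE)
  assume cont: "continuous_case \<mu>" "integrable_kernel_continuous U K" "division_in_L2 \<mu> U K L"
  then obtain A B where AB: "open U" "smooth_on_open U A" "smooth_on_open U B" "lin_indep_on U A B"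
      "\<forall>x\<in>U. \<not> (A x = 0 \<and> B x = 0)" "integrable_kernel_off_diag U A B K"
    unfolding integrable_kernel_continuous_def by blast
  interpret integrable_kernel_projection \<mu> L P K U A B
    using assms AB by unfold_locales auto
  have smooth: "continuous_on U F" if "smooth_on_open U F" for F
  proof (rule continuous_at_imp_continuous_on, rule ballI)
    fix x assume "x \<in> U"
    then have "((\<lambda>G t. vector_derivative G (at t)) ^^ 0) F differentiable (at x)"
      using that unfolding smooth_on_open_def by blast
    then show "isCont F x" by (simp add: differentiable_imp_continuous_within)
  qed
  have no_atoms: "\<forall>x. AE t in \<mu>. t \<noteq> x"
  proof
    fix x
    have "{x} \<in> null_sets \<mu>"
      using cont(1) assms(1) by (auto simp: continuous_case_def null_sets_def)
    then show "AE t in \<mu>. t \<noteq> x" using AE_not_in by fastforce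
  qed
  have "AE q in \<mu>. AE x in \<mu>. cnj (v q x) = v q x"
    using kernel_real_no_atoms[OF assms(2) no_atoms AB(1)] smooth AB(2,3) by blast
  moreover have "(\<lambda>x. \<phi> x / complex_of_real (x - p)) \<in> L2_space \<mu>"
    using cont(3) assms(10-12) unfolding division_in_L2_def by blast
  moreover have "AE t in \<mu>. of_real (t - p) * (\<phi> t / complex_of_real (t - p)) = \<phi> t"
    using no_atoms[rule_format, of p] by eventually_elim simp
  ultimately show ?thesis
    using division_everywhere no_atoms assms(10-12) by blast
next
  assume disc: "discrete_case \<mu> U" "integrable_kernel_discrete U K"
  then obtain A B where AB: "lin_indep_on U A B"
      "\<forall>x\<in>U. \<not> (A x = 0 \<and> B x = 0)" "integrable_kernel_off_diag U A B K"
    unfolding integrable_kernel_discrete_def by blast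
  interpret integrable_kernel_projection \<mu> L P K U A B
    using assms AB by unfold_locales auto
  have everywhere: "\<forall>Q. (AE t in \<mu>. Q t) \<longrightarrow> (\<forall>x\<in>U. Q x)"
    using discrete_case_AE_imp[OF disc(1)] by blast
  have "\<phi> p = 0"
    using everywhere value_at_AE[OF assms(11)] assms(10,12) by force
  then have "AE t in \<mu>. of_real (t - p) * (\<phi> t / complex_of_real (t - p)) = \<phi> t"
    by (intro AE_I2) auto
  moreover have "(\<lambda>x. \<phi> x / complex_of_real (x - p)) \<in> L2_space \<mu>"
    by (rule discrete_case_divide_L2[OF disc(1) AE_in_U L_sub[OF assms(11)]])
  ultimately show ?thesis
    using division_everywhere[OF kernel_real_atoms[OF everywhere]] everywhere assms(10-12) by blast
qed

end
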